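(* The map $\varphi:\mathbb{H}\to M_{4\times 4}(\mathbb{R})$, $\varphi(Z)=M(Z)$, where for $Z=a+b_1h^1+b_2h^2+b_3h^3\in\mathbb{H}$ $$M(Z)=\begin{bmatrix} a & -b_1+b_2 & b_1 & b_3\\ b_1 & a-b_3 & 0 & b_1\\ b_2 & -b_3 & a+b_3 & b_1-b_2\\ b_3 & b_2 & -b_1 & a\end{bmatrix},$$ is a ring homomorphism.
   Context: $\mathbb{H}$ denotes the set of hybrid numbers $\{a+b_1h^1+b_2h^2+b_3h^3 : a,b_1,b_2,b_3\in\mathbb{R}\}$, i.e. the real vector space with basis $1,h^1,h^2,h^3$ (superscripts are indices, not powers), with componentwise addition and with the $\mathbb{R}$-bilinear multiplication having unit $1$ and determined by $h^1h^1=-1$, $h^1h^2=1-h^3$, $h^1h^3=h^1+h^2$, $h^2h^1=1+h^3$, $h^2h^2=0$, $h^2h^3=-h^2$, $h^3h^1=-h^1-h^2$, $h^3h^2=h^2$, $h^3h^3=1$. *)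

theory Defs
  imports
    "HOL-Algebra.Algebraic_Closure_Type"
    "HOL-Algebra.RingHom"
    "Jordan_Normal_Form.Matrix"
begin

text \<open>
  \<open>Hybrid a b1 b2 b3\<close> is the hybrid number \<open>a + b1 h\<^sup>1 + b2 h\<^sup>2 + b3 h\<^sup>3\<close>; the superscripts are
  indices, not powers (see \<open>Hybrid_eq_basis\<close> below).
\<close>

datatype hybrid = Hybrid (hc0: real) (hc1: real) (hc2: real) (hc3: real)

lemma hybrid_eq_iff:
  "x = y \<longleftrightarrow> hc0 x = hc0 y \<and> hc1 x = hc1 y \<and> hc2 x = hc2 y \<and> hc3 x = hc3 y"
  by (cases x; cases y) simp

instantiation hybrid :: real_vector
begin

definition "0 = Hybrid 0 0 0 0"
definition "x + y = Hybrid (hc0 x + hc0 y) (hc1 x + hc1 y) (hc2 x + hc2 y) (hc3 x + hc3 y)"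
definition "- x = Hybrid (- hc0 x) (- hc1 x) (- hc2 x) (- hc3 x)"
definition "x - y = Hybrid (hc0 x - hc0 y) (hc1 x - hc1 y) (hc2 x - hc2 y) (hc3 x - hc3 y)"
definition "r *\<^sub>R x = Hybrid (r * hc0 x) (r * hc1 x) (r * hc2 x) (r * hc3 x)"

instance
  by standard
    (simp_all add: hybrid_eq_iff zero_hybrid_def plus_hybrid_def uminus_hybrid_def
      minus_hybrid_def scaleR_hybrid_def algebra_simps)

end

definition h1 :: hybrid where "h1 = Hybrid 0 1 0 0"
definition h2 :: hybrid where "h2 = Hybrid 0 0 1 0"
definition h3 :: hybrid where "h3 = Hybrid 0 0 0 1"

instantiation hybrid :: real_algebra_1
begin

definition "1 = Hybrid 1 0 0 0"

text \<open>The bilinear extension of the multiplication table of \<open>1, h1, h2, h3\<close>.\<close>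

definition
  "x * y =
     (hc0 x * hc0 y) *\<^sub>R 1  + (hc0 x * hc1 y) *\<^sub>R h1         + (hc0 x * hc2 y) *\<^sub>R h2       + (hc0 x * hc3 y) *\<^sub>R h3
   + (hc1 x * hc0 y) *\<^sub>R h1 + (hc1 x * hc1 y) *\<^sub>R (- 1)      + (hc1 x * hc2 y) *\<^sub>R (1 - h3) + (hc1 x * hc3 y) *\<^sub>R (h1 + h2)
   + (hc2 x * hc0 y) *\<^sub>R h2 + (hc2 x * hc1 y) *\<^sub>R (1 + h3)   + (hc2 x * hc2 y) *\<^sub>R 0        + (hc2 x * hc3 y) *\<^sub>R (- h2)
   + (hc3 x * hc0 y) *\<^sub>R h3 + (hc3 x * hc1 y) *\<^sub>R (- h1 - h2) + (hc3 x * hc2 y) *\<^sub>R h2     + (hc3 x * hc3 y) *\<^sub>R 1"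

instance
  by standard
    (simp_all add: hybrid_eq_iff zero_hybrid_def plus_hybrid_def uminus_hybrid_def
      minus_hybrid_def scaleR_hybrid_def one_hybrid_def times_hybrid_def h1_def h2_def h3_def
      algebra_simps)

end

lemma Hybrid_eq_basis:
  "Hybrid a b1 b2 b3 = a *\<^sub>R 1 + b1 *\<^sub>R h1 + b2 *\<^sub>R h2 + b3 *\<^sub>R h3"
  by (simp add: plus_hybrid_def scaleR_hybrid_def one_hybrid_def h1_def h2_def h3_def)

lemma hybrid_mult_table:
  "h1 * h1 = - 1"        "h1 * h2 = 1 - h3"  "h1 * h3 = h1 + h2"
  "h2 * h1 = 1 + h3"     "h2 * h2 = 0"       "h2 * h3 = - h2"
  "h3 * h1 = - h1 - h2"  "h3 * h2 = h2"      "h3 * h3 = 1"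
  by (simp_all add: times_hybrid_def h1_def h2_def h3_def)

primrec hybrid_mat :: "hybrid \<Rightarrow> real mat" where
  "hybrid_mat (Hybrid a b1 b2 b3) = mat_of_rows_list 4
     [[a,  - b1 + b2, b1,     b3],
      [b1, a - b3,    0,      b1],
      [b2, - b3,      a + b3, b1 - b2],
      [b3, b2,        - b1,   a]]"

end

theory Submission
  imports Defs
begin

text \<open>
  The columns of \<open>hybrid_mat z\<close> are the coordinates of \<open>z * 1\<close>, \<open>z * h1\<close>, \<open>z * h2\<close> and \<open>z * h3\<close>, so
  \<open>hybrid_mat\<close> is the left regular representation of the associative algebra of hybrid numbers.
\<close>

text \<open>The record \<open>ring_of_type_algebra\<close> has the whole type as carrier and the
  type class operations as its own, so each ring axiom is a class law. This makes the hybrid numbers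
  the domain of the homomorphism.\<close>

lemma ring_ring_of_type_algebra: "ring (ring_of_type_algebra :: 'a::ring_1 ring)"
proof (rule ringI)
  show "abelian_group (ring_of_type_algebra :: 'a ring)"
  proof (rule abelian_groupI)
    fix x :: 'a
    show "\<exists>y\<in>carrier ring_of_type_algebra. y \<oplus>\<^bsub>ring_of_type_algebra\<^esub> x = \<zero>\<^bsub>ring_of_type_algebra\<^esub>"
      unfolding ring_of_type_algebra_def by (simp add: exI[of _ "- x"])
  qed (simp_all add: ring_of_type_algebra_def add.assoc add.commute)
  show "Group.monoid (ring_of_type_algebra :: 'a ring)"
    by (rule monoidI) (simp_all add: ring_of_type_algebra_def mult.assoc)
qed (simp_all add: ring_of_type_algebra_def distrib_left distrib_right)

text \<open>Listing the indices as an explicit finite set lets \<open>auto\<close> split a matrix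
  equation into sixteen scalar ones.\<close>

lemma mat4_eqI:
  assumes "A \<in> carrier_mat 4 4" "B \<in> carrier_mat 4 4"
    and "\<And>i j. i \<in> {0, 1, 2, 3} \<Longrightarrow> j \<in> {0, 1, 2, 3} \<Longrightarrow> A $$ (i, j) = B $$ (i, j)"
  shows "A = B"
proof (rule eq_matI)
  have "i \<in> {0, 1, 2, 3}" if "i < 4" for i :: nat
    using that by auto
  then show "A $$ (i, j) = B $$ (i, j)" if "i < dim_row B" "j < dim_col B" for i j
    using that assms by auto
qed (use assms in auto)

lemma hybrid_mat_carrier [simp]: "hybrid_mat z \<in> carrier_mat 4 4"
  by (cases z; rule carrier_matI; simp add: mat_of_rows_list_def)

text \<open>Selectors replace the constructor pattern of \<open>hybrid_mat\<close>, so entries of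
  \<open>hybrid_mat (x + y)\<close> and \<open>hybrid_mat (x * y)\<close> can be read off
  directly.\<close>

lemma hybrid_mat_index:
  assumes "i < 4" "j < 4"
  shows "hybrid_mat z $$ (i, j) =
    [[hc0 z, - hc1 z + hc2 z, hc1 z,         hc3 z],
     [hc1 z, hc0 z - hc3 z,   0,             hc1 z],
     [hc2 z, - hc3 z,         hc0 z + hc3 z, hc1 z - hc2 z],
     [hc3 z, hc2 z,           - hc1 z,       hc0 z]] ! i ! j"
  using assms by (cases z) (simp add: mat_of_rows_list_def)

lemma hybrid_mat_add: "hybrid_mat (x + y) = hybrid_mat x + hybrid_mat y"
proof (rule mat4_eqI)
  have coords: "hc0 (x + y) = hc0 x + hc0 y" "hc1 (x + y) = hc1 x + hc1 y"
    "hc2 (x + y) = hc2 x + hc2 y" "hc3 (x + y) = hc3 x + hc3 y"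
    by (simp_all add: plus_hybrid_def)
  \<comment> \<open>The entry rule for a matrix sum has side conditions on the dimensions of the
    second summand.\<close>
  have dims: "dim_row (hybrid_mat y) = 4" "dim_col (hybrid_mat y) = 4"
    by (rule carrier_matD[OF hybrid_mat_carrier])+
  show "hybrid_mat (x + y) $$ (i, j) = (hybrid_mat x + hybrid_mat y) $$ (i, j)"
    if "i \<in> {0, 1, 2, 3}" "j \<in> {0, 1, 2, 3}" for i j
    using that by (auto simp: hybrid_mat_index coords dims)
qed simp_all

lemma hybrid_mat_one: "hybrid_mat 1 = 1\<^sub>m 4"
proof (rule mat4_eqI)
  have "hc0 1 = 1" "hc1 1 = 0" "hc2 1 = 0" "hc3 1 = 0"
    by (simp_all add: one_hybrid_def)
  then show "hybrid_mat 1 $$ (i, j) = 1\<^sub>m 4 $$ (i, j)"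
    if "i \<in> {0, 1, 2, 3}" "j \<in> {0, 1, 2, 3}" for i j
    using that by (auto simp: hybrid_mat_index)
qed simp_all

lemma mult_mat4_index:
  fixes A B :: "'a::comm_semiring_1 mat"
  assumes "A \<in> carrier_mat 4 4" "B \<in> carrier_mat 4 4" "i < 4" "j < 4"
  shows "(A * B) $$ (i, j) = A $$ (i, 0) * B $$ (0, j) + A $$ (i, 1) * B $$ (1, j)
    + A $$ (i, 2) * B $$ (2, j) + A $$ (i, 3) * B $$ (3, j)"
proof -
  \<comment> \<open>The scalar product sums over \<open>{0..<4}\<close>; enumerating this set
    unrolls the sum into four terms.\<close>
  have "{0..<4} = {0, 1, 2, 3::nat}"
    by auto
  then show ?thesis
    using assms by (simp add: scalar_prod_def add.assoc)
qed

text \<open>Conceptually this is \<open>(x * y) * e = x * (y * e)\<close> for each basis element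
  \<open>e\<close>; here it is checked entry by entry.\<close>

lemma hybrid_mat_mult: "hybrid_mat (x * y) = hybrid_mat x * hybrid_mat y"
proof (rule mat4_eqI)
  \<comment> \<open>The multiplication table, regrouped by basis element.\<close>
  have coords:
    "hc0 (x * y) = hc0 x * hc0 y - hc1 x * hc1 y + hc1 x * hc2 y + hc2 x * hc1 y + hc3 x * hc3 y"
    "hc1 (x * y) = hc0 x * hc1 y + hc1 x * hc0 y + hc1 x * hc3 y - hc3 x * hc1 y"
    "hc2 (x * y) = hc0 x * hc2 y + hc1 x * hc3 y + hc2 x * hc0 y - hc2 x * hc3 y
      - hc3 x * hc1 y + hc3 x * hc2 y"
    "hc3 (x * y) = hc0 x * hc3 y - hc1 x * hc2 y + hc2 x * hc1 y + hc3 x * hc0 y"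
    by (simp_all add: times_hybrid_def plus_hybrid_def minus_hybrid_def uminus_hybrid_def
        scaleR_hybrid_def one_hybrid_def zero_hybrid_def h1_def h2_def h3_def)
  fix i j :: nat
  assume "i \<in> {0, 1, 2, 3}" "j \<in> {0, 1, 2, 3}"
  then show "hybrid_mat (x * y) $$ (i, j) = (hybrid_mat x * hybrid_mat y) $$ (i, j)"
    \<comment> \<open>Each entry is now a polynomial identity in the eight coordinates of
      \<open>x\<close> and \<open>y\<close>.\<close>
    by (auto simp: mult_mat4_index hybrid_mat_index coords algebra_simps)
qed (rule hybrid_mat_carrier, rule mult_carrier_mat[OF hybrid_mat_carrier hybrid_mat_carrier])

theorem theorem3p1:
  shows "ring_hom_ring (ring_of_type_algebra :: hybrid ring) (ring_mat TYPE(real) 4 ()) hybrid_mat"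
proof (rule ring_hom_ringI)
  show "ring (ring_of_type_algebra :: hybrid ring)"
    by (rule ring_ring_of_type_algebra)
  show "ring (ring_mat TYPE(real) 4 ())"
    by (rule ring_mat)
  fix x y :: hybrid
  show "hybrid_mat x \<in> carrier (ring_mat TYPE(real) 4 ())" by (simp add: ring_mat_def)
  show "hybrid_mat (x \<otimes>\<^bsub>ring_of_type_algebra\<^esub> y) = hybrid_mat x \<otimes>\<^bsub>ring_mat TYPE(real) 4 ()\<^esub> hybrid_mat y"
    by (simp add: ring_mat_def ring_of_type_algebra_def hybrid_mat_mult)
  show "hybrid_mat (x \<oplus>\<^bsub>ring_of_type_algebra\<^esub> y) = hybrid_mat x \<oplus>\<^bsub>ring_mat TYPE(real) 4 ()\<^esub> hybrid_mat y"
    by (simp add: ring_mat_def ring_of_type_algebra_def hybrid_mat_add)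
  show "hybrid_mat \<one>\<^bsub>ring_of_type_algebra\<^esub> = \<one>\<^bsub>ring_mat TYPE(real) 4 ()\<^esub>"
    by (simp add: ring_mat_def ring_of_type_algebra_def hybrid_mat_one)
qed

end
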